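(* Let $v$ be a solution of the Lorenz equation $\frac{dv}{dt}+Av+B(v,v)=f$ with $v(0)\in\mathcal{A}$, where $\mathcal{A}$ is the global attractor of this equation. Assume that the observational noise is Gaussian, i.e. $(\xi_k)_{k\ge1}$ are i.i.d. with $\xi_1\sim N(0,1)$. Let $(m_k)_{k\ge 0}$ be the discrete time 3DVAR filter with observation spacing $h>0$ and parameter $\eta>0$ (as defined in the context), and let $\delta_k=m_k-v(kh)$. Then there exist $h_c>0$ and $\lambda>0$ such that for all $\eta>0$ sufficiently small (i.e. for all $\eta\in(0,\eta_0)$ for some $\eta_0>0$) and all $h\in(0,h_c)$, $$\mathbb{E}\|\delta_{k+1}\|^2\le(1-\lambda h)\,\mathbb{E}\|\delta_k\|^2+2\epsilon^2\qquad\text{for all } k\ge 0.$$ Consequently $$\limsup_{k\to\infty}\mathbb{E}\|\delta_k\|^2\le\frac{2\epsilon^2}{\lambda h}.$$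
   Context: Fix parameters $\alpha>1$, $b>1$, $r>0$ and a noise level $\epsilon>0$. The Lorenz '63 equation (in shifted coordinates) is the ODE in $\mathbb{R}^3$, $u=(u_x,u_y,u_z)$, $$\frac{du}{dt}+Au+B(u,u)=f,$$ where $$A=\begin{pmatrix}\alpha&-\alpha&0\\ \alpha&1&0\\ 0&0&b\end{pmatrix},\quad f=\begin{pmatrix}0\\0\\-b(r+\alpha)\end{pmatrix},\quad B(u,\tilde u)=\begin{pmatrix}0\\ (u_x\tilde u_z+u_z\tilde u_x)/2\\ -(u_x\tilde u_y+u_y\tilde u_x)/2\end{pmatrix}.$$ It has a global attractor $\mathcal{A}\subset\mathbb{R}^3$. Every $u\in\mathcal A$ satisfies $|u|^2\le K$ with $K=\frac{b^2(r+\alpha)^2}{4(b-1)}$. For $h>0$, $\Psi:\mathbb{R}^3\to\mathbb{R}^3$ denotes the time-$h$ solution map of this ODE. Let $P=\mathrm{diag}(1,0,0)$, $Q=\mathrm{diag}(0,1,1)$, $H=(1,0,0)$ (so only the $x$-component is observed). $|\cdot|$ is the Euclidean norm on $\mathbb{R}^3$ and $\|u\|^2:=|u|^2+|Pu|^2$. Data and filter: with $v_k=v(kh)$, the observations are $y_{k+1}=Hv_{k+1}+\epsilon\xi_{k+1}$, $k\ge0$, where $\xi_1,\xi_2,\dots$ are i.i.d. real random variables. The discrete time 3DVAR filter (with observation covariance $\Gamma=\epsilon^2$ and model covariance $C=\eta^{-1}\epsilon^2I$, $\eta>0$) starts from a given (deterministic) $m_0\in\mathbb{R}^3$ and is defined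 by $$m_{k+1}=\Big(\frac{\eta}{1+\eta}P+Q\Big)\Psi(m_k)+\frac{1}{1+\eta}\,y_{k+1}H^{*},\qquad k\ge0,$$ where $H^*=(1,0,0)^T$. *)

theory Defs
  imports "HOL-Probability.Probability"
begin

definition lorenz_A :: "real \<Rightarrow> real \<Rightarrow> real^3^3" where
  "lorenz_A \<alpha> b = vector [vector [\<alpha>, - \<alpha>, 0], vector [\<alpha>, 1, 0], vector [0, 0, b]]"

definition lorenz_B :: "real^3 \<Rightarrow> real^3 \<Rightarrow> real^3" where
  "lorenz_B u w = vector [0, (u$1 * w$3 + u$3 * w$1) / 2, - (u$1 * w$2 + u$2 * w$1) / 2]"

definition lorenz_f :: "real \<Rightarrow> real \<Rightarrow> real \<Rightarrow> real^3" where
  "lorenz_f \<alpha> b r = vector [0, 0, - b * (r + \<alpha>)]"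

text \<open>Forward-in-time solutions of \<open>du/dt + A u + B(u,u) = f\<close>; at \<open>t = 0\<close> the derivative is one-sided.\<close>

definition lorenz_solution :: "real \<Rightarrow> real \<Rightarrow> real \<Rightarrow> (real \<Rightarrow> real^3) \<Rightarrow> bool" where
  "lorenz_solution \<alpha> b r u \<longleftrightarrow>
     (\<forall>t\<ge>0. (u has_vector_derivative
        (lorenz_f \<alpha> b r - lorenz_A \<alpha> b *v u t - lorenz_B (u t) (u t))) (at t within {0..}))"

text \<open>The time-\<open>t\<close> solution map, for \<open>t \<ge> 0\<close>. The initial value problem is well posed on
  \<open>[0,\<infinity>)\<close>, so the description denotes the value at time \<open>t\<close> of the solution from \<open>u\<^sub>0\<close>.\<close>

definition lorenz_flow :: "real \<Rightarrow> real \<Rightarrow> real \<Rightarrow> real \<Rightarrow> real^3 \<Rightarrow> real^3" where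
  "lorenz_flow \<alpha> b r t u\<^sub>0 = (THE w. \<exists>u. lorenz_solution \<alpha> b r u \<and> u 0 = u\<^sub>0 \<and> u t = w)"

text \<open>A global attractor is a compact, strictly invariant set that attracts every bounded set,
  uniformly on that set. The attraction clause forces it to be nonempty, and the three clauses
  together determine it uniquely.\<close>

definition is_global_attractor :: "(real \<Rightarrow> 'a::metric_space \<Rightarrow> 'a) \<Rightarrow> 'a set \<Rightarrow> bool" where
  "is_global_attractor \<Phi> \<A> \<longleftrightarrow>
     compact \<A> \<and>
     (\<forall>t\<ge>0. \<Phi> t ` \<A> = \<A>) \<and>
     (\<forall>S. bounded S \<longrightarrow>
        (\<forall>e>0. \<forall>\<^sub>F t in at_top. \<forall>u\<in>S. \<exists>a\<in>\<A>. dist (\<Phi> t u) a < e))"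

definition proj_P :: "real^3^3" where
  "proj_P = vector [vector [1, 0, 0], vector [0, 0, 0], vector [0, 0, 0]]"

definition proj_Q :: "real^3^3" where
  "proj_Q = vector [vector [0, 0, 0], vector [0, 1, 0], vector [0, 0, 1]]"

text \<open>The row vector \<open>H = (1,0,0)\<close>: it acts by \<open>H u = obs_H \<bullet> u\<close>, and \<open>y H\<^sup>* = y *\<^sub>R obs_H\<close>
  for a scalar observation \<open>y\<close>.\<close>

definition obs_H :: "real^3" where
  "obs_H = vector [1, 0, 0]"

text \<open>The squared norm \<open>\<parallel>u\<parallel>\<^sup>2 = |u|\<^sup>2 + |P u|\<^sup>2\<close>, where \<open>norm\<close> is the Euclidean norm \<open>|.|\<close>.\<close>

definition sq_norm :: "real^3 \<Rightarrow> real" where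
  "sq_norm u = (norm u)\<^sup>2 + (norm (proj_P *v u))\<^sup>2"

text \<open>\<open>\<xi>\<close> is a single realization of the noise sequence; only the indices \<open>k \<ge> 1\<close> are used below.\<close>

definition observation ::
  "real \<Rightarrow> (real \<Rightarrow> real^3) \<Rightarrow> real \<Rightarrow> (nat \<Rightarrow> real) \<Rightarrow> nat \<Rightarrow> real" where
  "observation \<epsilon> v h \<xi> k = obs_H \<bullet> v (real k * h) + \<epsilon> * \<xi> k"

primrec three_dvar ::
  "real \<Rightarrow> (real^3 \<Rightarrow> real^3) \<Rightarrow> real^3 \<Rightarrow> (nat \<Rightarrow> real) \<Rightarrow> nat \<Rightarrow> real^3" where
  "three_dvar \<eta> \<Psi> m\<^sub>0 y 0 = m\<^sub>0"
| "three_dvar \<eta> \<Psi> m\<^sub>0 y (Suc k) =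
     ((\<eta> / (1 + \<eta>)) *\<^sub>R proj_P + proj_Q) *v \<Psi> (three_dvar \<eta> \<Psi> m\<^sub>0 y k)
       + (1 / (1 + \<eta>)) *\<^sub>R (y (Suc k) *\<^sub>R obs_H)"

definition filter_error ::
  "real \<Rightarrow> real \<Rightarrow> real \<Rightarrow> real \<Rightarrow> real \<Rightarrow> real \<Rightarrow> (real \<Rightarrow> real^3) \<Rightarrow> real^3 \<Rightarrow> (nat \<Rightarrow> real) \<Rightarrow> nat \<Rightarrow> real^3"
where
  "filter_error \<alpha> b r \<epsilon> \<eta> h v m\<^sub>0 \<xi> k =
     three_dvar \<eta> (lorenz_flow \<alpha> b r h) m\<^sub>0 (observation \<epsilon> v h \<xi>) k - v (real k * h)"

end

theory Submission
  imports Defs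
begin

text \<open>Write \<open>u - v = (x, y, z)\<close> for the difference of two Lorenz solutions with \<open>|v| \<le> K\<close>. The
  quadratic terms in the difference cancel in the energy balance. Hence
  \<open>F t = (2 - D t) x\<^sup>2 + y\<^sup>2 + z\<^sup>2\<close> satisfies \<open>F' \<le> - F / 2\<close> as long as \<open>D t \<le> 1\<close>, provided that \<open>D\<close>
  is large in terms of \<open>\<alpha>\<close> and \<open>K\<close>. Since \<open>F 0\<close> is \<open>sq_norm\<close> of the initial difference, one
  forecast step contracts \<open>sq_norm\<close> into the Euclidean norm by the factor \<open>1 - h / 4\<close>. The analysis
  step damps \<open>x\<close> by \<open>\<eta> / (1 + \<eta>) \<le> 1 / 2\<close>, which compensates the weight \<open>2\<close> of \<open>x\<^sup>2\<close>, and adds noise that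
  is independent of the forecast error, so no cross term survives in the mean. Along \<open>v\<close> the bound
  \<open>K\<close> comes from the compactness of the attractor.\<close>

section \<open>Differential equations\<close>

text \<open>With the unknown rescaled by \<open>exp (- a t)\<close>, the Picard operator contracts on all of \<open>[0,\<infinity>)\<close> at
  once, so no continuation argument is needed.\<close>

lemma lipschitz_ode_global_solution:
  fixes G :: "'a::euclidean_space \<Rightarrow> 'a" and u\<^sub>0 :: 'a
  assumes lip: "L-lipschitz_on UNIV G"
  shows "\<exists>u. u 0 = u\<^sub>0 \<and> (\<forall>t\<ge>0. (u has_vector_derivative G (u t)) (at t within {0..}))"
proof -
  \<comment> \<open>Any \<open>a \<ge> 2 * L\<close> makes the contraction factor
    \<open>L / a\<close> at most \<open>1 / 2\<close>; the summand 1 keeps \<open>a\<close> positive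
    when \<open>L = 0\<close>.\<close>
  define a where "a = 2 * L + 1"
  have L: "0 \<le> L" and a: "0 < a" "L / a \<le> 1 / 2"
    using lipschitz_on_nonneg[OF lip] by (auto simp: a_def)
  have lipD: "norm (G x - G y) \<le> L * norm (x - y)" for x y
    using lipschitz_on_normD[OF lip] by auto
  have contG: "continuous_on S G" for S
    using lipschitz_on_continuous_on[OF lip] continuous_on_subset by blast
  define I where "I w t = integral {0..t} (\<lambda>s. G (exp (a * s) *\<^sub>R apply_bcontfun w s))"
    for w :: "real \<Rightarrow>\<^sub>C 'a" and t
  \<comment> \<open>Here \<open>w t\<close> stands for \<open>exp (- a t)\<close> times the unknown.
    Bounded continuous functions live on the whole line, so \<open>max 0 t\<close> extends the
    operator to negative times by its value at 0.\<close>
  define T where "T w t = exp (- (a * max 0 t)) *\<^sub>R (u\<^sub>0 + I w (max 0 t))" for w t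
  have integrand_cont: "continuous_on S (\<lambda>s. G (exp (a * s) *\<^sub>R apply_bcontfun w s))" for w S
    by (rule continuous_on_compose2[OF contG[of UNIV]]) (auto intro!: continuous_intros)
  have I_deriv: "((\<lambda>t. I w t) has_vector_derivative G (exp (a * t) *\<^sub>R apply_bcontfun w t))
      (at t within {0..})" if "0 \<le> t" for w t
  proof -
    \<comment> \<open>The integral is differentiated on a compact interval. Ending it at
      \<open>t + 1\<close> keeps \<open>t\<close> off the right endpoint, so the derivative is the
      same as within \<open>{0..}\<close>.\<close>
    have "((\<lambda>t. I w t) has_vector_derivative G (exp (a * t) *\<^sub>R apply_bcontfun w t))
        (at t within {0..t+1})"
      unfolding I_def using that by (intro integral_has_vector_derivative integrand_cont) auto
    moreover have "at t within {0..t+1} = at t within {0..}"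
      by (rule at_within_nhd[of _ "{..<t+1}"]) auto
    ultimately show ?thesis by simp
  qed
  have I_cont: "continuous_on {0..} (I w)" for w
    by (meson I_deriv atLeast_iff continuous_on_eq_continuous_within has_vector_derivative_continuous)
  have exp_int: "((\<lambda>s. C * exp (a * s)) has_integral C / a * (exp (a * t) - 1)) {0..t}"
    if "0 \<le> t" for C t
  proof -
    have "((\<lambda>s. C * exp (a * s)) has_integral C / a * exp (a * t) - C / a * exp (a * 0)) {0..t}"
      using that a by (intro fundamental_theorem_of_calculus)
        (auto intro!: derivative_eq_intros
          simp flip: has_real_derivative_iff_has_vector_derivative)
    then show ?thesis by (simp add: algebra_simps)
  qed
  \<comment> \<open>Integrating a bound \<open>C * exp (a * s)\<close> gains the factor
    \<open>1 / a\<close>; this is what beats the Lipschitz constant, and the weight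
    \<open>exp (- a t)\<close> in \<open>T\<close> absorbs the exponential.\<close>
  have int_bound: "norm (integral {0..t} f) \<le> C / a * exp (a * t)"
    if "0 \<le> t" "continuous_on {0..t} f" "0 \<le> C" "\<And>s. s \<in> {0..t} \<Longrightarrow> norm (f s) \<le> C * exp (a * s)"
    for f :: "real \<Rightarrow> 'a" and C t
  proof -
    have "norm (integral {0..t} f) \<le> integral {0..t} (\<lambda>s. C * exp (a * s))"
      using that exp_int[of t C]
      by (intro Henstock_Kurzweil_Integration.integral_norm_bound_integral)
        (auto intro: integrable_continuous_real)
    also have "\<dots> = C / a * (exp (a * t) - 1)"
      using exp_int that by blast
    also have "\<dots> \<le> C / a * exp (a * t)"
      using that a by (intro mult_left_mono) auto
    finally show ?thesis .
  qed
  have T_cont: "continuous_on UNIV (T w)" for w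
    unfolding T_def
    by (intro continuous_intros continuous_on_compose2[OF I_cont[of w]]) auto
  have T_bdd: "norm (T w t) \<le> norm u\<^sub>0 + (norm (G 0) + L * norm w) / a" for w t
  proof -
    define s where "s = max 0 t"
    have s: "0 \<le> s" by (simp add: s_def)
    have "norm (I w s) \<le> (norm (G 0) + L * norm w) / a * exp (a * s)"
      unfolding I_def
    proof (rule int_bound[OF s integrand_cont])
      show "0 \<le> norm (G 0) + L * norm w" using L by simp
      fix r assume r: "r \<in> {0..s}"
      have "norm (G (exp (a * r) *\<^sub>R apply_bcontfun w r))
          \<le> norm (G 0) + L * (exp (a * r) * norm (apply_bcontfun w r))"
        using lipD[of "exp (a * r) *\<^sub>R apply_bcontfun w r" 0]
          norm_triangle_sub[of "G (exp (a * r) *\<^sub>R apply_bcontfun w r)" "G 0"] by simp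
      also have "\<dots> \<le> norm (G 0) * exp (a * r) + L * (exp (a * r) * norm w)"
        using r a L norm_bounded[of w r]
        by (intro add_mono mult_left_mono) (auto simp: mult_le_cancel_left1)
      finally show "norm (G (exp (a * r) *\<^sub>R apply_bcontfun w r))
          \<le> (norm (G 0) + L * norm w) * exp (a * r)"
        by (simp add: algebra_simps)
    qed
    then have "norm (u\<^sub>0 + I w s) \<le> norm u\<^sub>0 + (norm (G 0) + L * norm w) / a * exp (a * s)"
      by (meson add_left_mono norm_triangle_ineq order_trans)
    also have "\<dots> \<le> norm u\<^sub>0 * exp (a * s) + (norm (G 0) + L * norm w) / a * exp (a * s)"
      using s a by (auto simp: mult_le_cancel_left1)
    finally have "exp (- (a * s)) * norm (u\<^sub>0 + I w s) \<le> exp (- (a * s)) *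
        ((norm u\<^sub>0 + (norm (G 0) + L * norm w) / a) * exp (a * s))"
      by (intro mult_left_mono) (auto simp: algebra_simps)
    also have "\<dots> = norm u\<^sub>0 + (norm (G 0) + L * norm w) / a"
      by (simp add: exp_minus)
    finally show ?thesis by (simp add: T_def s_def)
  qed
  have T_mem: "T w \<in> bcontfun" for w
    unfolding bcontfun_def bounded_iff using T_cont T_bdd by blast
  then have app: "apply_bcontfun (Bcontfun (T w)) = T w" for w
    by (simp add: Bcontfun_inverse)
  have "\<exists>!w. Bcontfun (T w) = w"
  proof (rule banach_fix_type[where c = "1/2"])
    show "\<forall>w w'. dist (Bcontfun (T w)) (Bcontfun (T w')) \<le> 1 / 2 * dist w w'"
    proof (intro allI dist_bound)
      fix w w' and t :: real
      define s where "s = max 0 t"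
      have s: "0 \<le> s" by (simp add: s_def)
      have "I w s - I w' s = integral {0..s}
          (\<lambda>r. G (exp (a * r) *\<^sub>R apply_bcontfun w r) - G (exp (a * r) *\<^sub>R apply_bcontfun w' r))"
        unfolding I_def by (intro integral_diff[symmetric] integrable_continuous_real integrand_cont)
      also have "norm \<dots> \<le> (L * dist w w') / a * exp (a * s)"
      proof (rule int_bound[OF s])
        fix r assume "r \<in> {0..s}"
        have "norm (G (exp (a * r) *\<^sub>R apply_bcontfun w r) - G (exp (a * r) *\<^sub>R apply_bcontfun w' r))
            \<le> L * norm (exp (a * r) *\<^sub>R (apply_bcontfun w r - apply_bcontfun w' r))"
          using lipD by (simp add: scaleR_diff_right)
        also have "\<dots> \<le> L * (exp (a * r) * dist w w')"
          using L dist_bounded[of w r w'] by (auto simp: dist_norm intro!: mult_left_mono)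
        finally show "norm (G (exp (a * r) *\<^sub>R apply_bcontfun w r) - G (exp (a * r) *\<^sub>R apply_bcontfun w' r))
            \<le> L * dist w w' * exp (a * r)"
          by (simp add: algebra_simps)
      qed (use L in \<open>auto intro!: continuous_intros integrand_cont\<close>)
      finally have "exp (- (a * s)) * norm (I w s - I w' s)
          \<le> exp (- (a * s)) * ((L * dist w w') / a * exp (a * s))"
        by (intro mult_left_mono) auto
      also have "\<dots> = L / a * dist w w'" by (simp add: exp_minus)
      also have "\<dots> \<le> 1 / 2 * dist w w'" using a by (intro mult_right_mono) auto
      finally show "dist (apply_bcontfun (Bcontfun (T w)) t) (apply_bcontfun (Bcontfun (T w')) t)
          \<le> 1 / 2 * dist w w'"
        by (simp add: app T_def dist_norm s_def flip: scaleR_diff_right)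
    qed
  qed auto
  then obtain w where w: "apply_bcontfun w = T w"
    using app by metis
  define u where "u t = u\<^sub>0 + I w t" for t
  \<comment> \<open>The fixed-point equation times \<open>exp (a * t)\<close>: it identifies the
    argument of \<open>G\<close> inside \<open>I w\<close> with \<open>u\<close> itself.\<close>
  have u: "u t = exp (a * t) *\<^sub>R apply_bcontfun w t" if "0 \<le> t" for t
    using that by (simp add: w T_def u_def exp_minus max_def)
  have "u 0 = u\<^sub>0"
    by (simp add: u_def I_def)
  moreover have "(u has_vector_derivative G (u t)) (at t within {0..})" if "0 \<le> t" for t
    using has_vector_derivative_add[OF has_vector_derivative_const[of u\<^sub>0] I_deriv[OF that, of w]]
    unfolding u[OF that] by (simp add: u_def[abs_def])
  ultimately show ?thesis by blast
qed

text \<open>The product \<open>exp (- c * t) * f t\<close> is nonincreasing. At points of the open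
  interval the one-sided derivative is two-sided; the endpoints enter by continuity.\<close>

lemma gronwall_forward:
  fixes f :: "real \<Rightarrow> real"
  assumes T: "0 \<le> T"
    and deriv: "\<And>t. 0 \<le> t \<Longrightarrow> t \<le> T \<Longrightarrow> (f has_real_derivative f' t) (at t within {0..})"
    and le: "\<And>t. 0 < t \<Longrightarrow> t < T \<Longrightarrow> f' t \<le> c * f t"
  shows "f T \<le> exp (c * T) * f 0"
proof -
  let ?g = "\<lambda>t. exp (- c * t) * f t"
  have cont: "continuous_on {0..T} f"
    by (rule DERIV_continuous_on) (auto intro: DERIV_subset[OF deriv])
  have "?g T \<le> ?g 0"
  proof (rule DERIV_nonpos_imp_decreasing_open[OF T])
    fix t assume t: "0 < t" "t < T"
    have "at t within {0..} = at t"
      using t by (intro at_within_interior) auto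
    then have f: "DERIV f t :> f' t"
      using deriv[of t] t by simp
    have "DERIV ?g t :> exp (- c * t) * (f' t - c * f t)"
      by (auto intro!: derivative_eq_intros f simp: algebra_simps)
    moreover have "exp (- c * t) * (f' t - c * f t) \<le> 0"
      using le[OF t] by (auto simp: mult_le_0_iff)
    ultimately show "\<exists>y. DERIV ?g t :> y \<and> y \<le> 0" by blast
  qed (intro continuous_intros cont)
  then have "exp (c * T) * ?g T \<le> exp (c * T) * f 0"
    by (intro mult_left_mono) auto
  then show ?thesis
    by (simp add: mult_exp_exp flip: mult.assoc)
qed

section \<open>The Lorenz vector field\<close>

definition lorenz_field :: "real \<Rightarrow> real \<Rightarrow> real \<Rightarrow> real^3 \<Rightarrow> real^3" where
  "lorenz_field \<alpha> b r u = lorenz_f \<alpha> b r - lorenz_A \<alpha> b *v u - lorenz_B u u"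

lemma lorenz_field_component:
  "lorenz_field \<alpha> b r u $ 1 = \<alpha> * (u$2 - u$1)"
  "lorenz_field \<alpha> b r u $ 2 = - \<alpha> * u$1 - u$2 - u$1 * u$3"
  "lorenz_field \<alpha> b r u $ 3 = - b * u$3 + u$1 * u$2 - b * (r + \<alpha>)"
  by (simp_all add: lorenz_field_def lorenz_f_def lorenz_A_def lorenz_B_def
      matrix_vector_mult_def sum_3 algebra_simps)

lemma norm_sq_3: "(norm u)\<^sup>2 = (u$1)\<^sup>2 + (u$2)\<^sup>2 + (u$3)\<^sup>2" for u :: "real^3"
  unfolding power2_norm_eq_inner by (simp add: inner_vec_def sum_3 power2_eq_square)

text \<open>The quadratic part of the field is orthogonal to \<open>u\<close>, and the off-diagonal
  part of the matrix is skew. What remains is damping of at least \<open>(norm u)\<^sup>2\<close>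
  against forcing of at most \<open>b * (r + \<alpha>) * norm u\<close>.\<close>

lemma inner_lorenz_field_nonpos:
  assumes "\<alpha> \<ge> 1" "b \<ge> 1" "r \<ge> 0" and R: "b * (r + \<alpha>) \<le> norm u"
  shows "u \<bullet> lorenz_field \<alpha> b r u \<le> 0"
proof -
  have "u \<bullet> lorenz_field \<alpha> b r u
      = - \<alpha> * (u$1)\<^sup>2 - (u$2)\<^sup>2 - b * (u$3)\<^sup>2 - b * (r + \<alpha>) * u$3"
    by (simp add: inner_vec_def sum_3 lorenz_field_component power2_eq_square algebra_simps)
  also have "\<dots> \<le> - (norm u)\<^sup>2 + b * (r + \<alpha>) * norm u"
  proof -
    have "(u$1)\<^sup>2 \<le> \<alpha> * (u$1)\<^sup>2" "(u$3)\<^sup>2 \<le> b * (u$3)\<^sup>2"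
      using assms by (auto simp: mult_le_cancel_right1)
    moreover have "b * (r + \<alpha>) * (- u$3) \<le> b * (r + \<alpha>) * norm u"
      using assms component_le_norm_cart[of u 3] by (intro mult_left_mono) auto
    ultimately show ?thesis by (simp add: norm_sq_3)
  qed
  also have "\<dots> = norm u * (b * (r + \<alpha>) - norm u)"
    by (simp add: power2_eq_square algebra_simps)
  also have "\<dots> \<le> 0"
    using R by (simp add: mult_le_0_iff)
  finally show ?thesis .
qed

lemma bounded_bilinear_lorenz_B: "bounded_bilinear lorenz_B"
proof -
  have "bilinear lorenz_B"
    unfolding bilinear_def
    by (intro conjI allI linearI)
      (simp_all add: lorenz_B_def vec_eq_iff forall_3 field_simps)
  then show ?thesis by (simp add: bilinear_conv_bounded_bilinear)
qed

section \<open>Cut-off of the field and global existence\<close>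

lemma lorenz_field_lipschitz_on_cball:
  assumes "0 \<le> R"
  shows "\<exists>L. L-lipschitz_on (cball 0 R) (lorenz_field \<alpha> b r)"
proof -
  interpret B: bounded_bilinear lorenz_B by (rule bounded_bilinear_lorenz_B)
  interpret A: bounded_linear "(*v) (lorenz_A \<alpha> b)" by (rule matrix_vector_mul_bounded_linear)
  obtain K where K: "\<And>x y. norm (lorenz_B x y) \<le> norm x * norm y * K" "0 \<le> K"
    using B.nonneg_bounded by blast
  obtain C where C: "\<And>x. norm (lorenz_A \<alpha> b *v x) \<le> norm x * C" "0 \<le> C"
    using A.nonneg_bounded by blast
  have "(C + 2 * R * K)-lipschitz_on (cball 0 R) (lorenz_field \<alpha> b r)"
  proof (rule lipschitz_onI)
    fix x y :: "real^3" assume xy: "x \<in> cball 0 R" "y \<in> cball 0 R"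
    have "lorenz_B x x - lorenz_B y y = lorenz_B (x - y) x + lorenz_B y (x - y)"
      by (simp add: B.diff_left B.diff_right)
    then have "norm (lorenz_B x x - lorenz_B y y)
        \<le> norm (lorenz_B (x - y) x) + norm (lorenz_B y (x - y))"
      by (metis norm_triangle_ineq)
    also have "\<dots> \<le> norm (x - y) * norm x * K + norm y * norm (x - y) * K"
      by (intro add_mono K)
    also have "\<dots> \<le> norm (x - y) * R * K + R * norm (x - y) * K"
      using xy K(2) by (intro add_mono mult_right_mono mult_left_mono) auto
    finally have "norm (lorenz_B x x - lorenz_B y y) \<le> 2 * R * K * norm (x - y)"
      by (simp add: algebra_simps)
    moreover have "norm (lorenz_A \<alpha> b *v (x - y)) \<le> C * norm (x - y)"
      using C(1)[of "x - y"] by (simp add: mult.commute)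
    moreover have "dist (lorenz_field \<alpha> b r x) (lorenz_field \<alpha> b r y)
        = norm (lorenz_A \<alpha> b *v (x - y) + (lorenz_B x x - lorenz_B y y))"
      unfolding dist_norm lorenz_field_def
      by (subst norm_minus_commute) (simp add: A.diff algebra_simps)
    ultimately show "dist (lorenz_field \<alpha> b r x) (lorenz_field \<alpha> b r y)
        \<le> (C + 2 * R * K) * dist x y"
      using norm_triangle_ineq[of "lorenz_A \<alpha> b *v (x - y)" "lorenz_B x x - lorenz_B y y"]
      by (simp add: dist_norm algebra_simps)
  qed (use assms K C in auto)
  then show ?thesis ..
qed

text \<open>Being radial outside the ball, the projection sends \<open>u\<close> to a positive
  multiple of itself. A sign of the inner product of the field with the projected point therefore
  carries over to \<open>u\<close>.\<close>

lemma closest_point_cball_scale: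
  fixes u :: "'a::euclidean_space"
  assumes "0 < R" "R \<le> norm u"
  shows "closest_point (cball 0 R) u = (R / norm u) *\<^sub>R u"
proof (rule closest_point_unique[symmetric])
  show "(R / norm u) *\<^sub>R u \<in> cball 0 R"
    using assms by auto
  show "\<forall>z\<in>cball 0 R. dist u ((R / norm u) *\<^sub>R u) \<le> dist u z"
  proof
    fix z :: 'a assume "z \<in> cball 0 R"
    have "u - (R / norm u) *\<^sub>R u = ((norm u - R) / norm u) *\<^sub>R u"
      using assms by (auto simp: diff_divide_distrib scaleR_diff_left)
    then have "dist u ((R / norm u) *\<^sub>R u) = norm u - R"
      using assms by (auto simp: dist_norm)
    also have "\<dots> \<le> norm u - norm z" using \<open>z \<in> _\<close> by simp
    also have "\<dots> \<le> dist u z" by (simp add: dist_norm norm_triangle_ineq2)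
    finally show "dist u ((R / norm u) *\<^sub>R u) \<le> dist u z" .
  qed
qed auto

text \<open>If the solution were outside at time \<open>t\<close>, consider its last visit
  \<open>Sup S\<close> to the ball before \<open>t\<close>. From then on its norm is at least
  \<open>R\<close>, where the squared norm cannot increase, so it cannot have left.\<close>

lemma cball_positively_invariant:
  fixes u :: "real \<Rightarrow> 'a::real_inner"
  assumes deriv: "\<And>t. 0 \<le> t \<Longrightarrow> (u has_vector_derivative g t) (at t within {0..})"
    and inward: "\<And>t. 0 \<le> t \<Longrightarrow> R \<le> norm (u t) \<Longrightarrow> u t \<bullet> g t \<le> 0"
    and init: "norm (u 0) \<le> R" and t: "0 \<le> t"
  shows "norm (u t) \<le> R"
proof (rule ccontr)
  assume out: "\<not> norm (u t) \<le> R"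
  have cont: "continuous_on {0..} u"
    by (meson deriv atLeast_iff continuous_on_eq_continuous_within has_vector_derivative_continuous)
  define S where "S = {s \<in> {0..t}. norm (u s) \<le> R}"
  have "closed S"
    unfolding S_def
    by (intro continuous_on_closed_Collect_le continuous_intros continuous_on_subset[OF cont]) auto
  moreover have S: "0 \<in> S" "bdd_above S"
    using init t by (auto simp: S_def intro!: bdd_aboveI[of _ t])
  ultimately have "Sup S \<in> S" by (intro closed_contains_Sup) auto
  then have s: "0 \<le> Sup S" "Sup S \<le> t" "norm (u (Sup S)) \<le> R" by (auto simp: S_def)
  have later: "R \<le> norm (u x)" if "Sup S < x" "x < t" for x
    using cSup_upper[of x S] that s S by (fastforce simp: S_def)
  have "u t \<bullet> u t \<le> u (Sup S) \<bullet> u (Sup S)"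
  proof (rule DERIV_nonpos_imp_decreasing_open[OF s(2)])
    show "continuous_on {Sup S..t} (\<lambda>x. u x \<bullet> u x)"
      using s by (intro continuous_intros continuous_on_subset[OF cont]) auto
    fix x assume x: "Sup S < x" "x < t"
    have "at x within {0..} = at x"
      using x s by (intro at_within_interior) auto
    then have "(u has_vector_derivative g x) (at x)"
      using deriv[of x] x s by simp
    then have "DERIV (\<lambda>x. u x \<bullet> u x) x :> 2 * (u x \<bullet> g x)"
      unfolding has_real_derivative_iff_has_vector_derivative has_vector_derivative_def
      by (auto intro!: derivative_eq_intros simp: inner_commute)
    moreover have "u x \<bullet> g x \<le> 0"
      using inward[of x] later[OF x] x s by simp
    ultimately show "\<exists>y. DERIV (\<lambda>x. u x \<bullet> u x) x :> y \<and> y \<le> 0" by fastforce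
  qed
  then show False
    using s(3) out by (simp flip: norm_le)
qed

lemma lorenz_solution_iff:
  "lorenz_solution \<alpha> b r u \<longleftrightarrow>
    (\<forall>t\<ge>0. (u has_vector_derivative lorenz_field \<alpha> b r (u t)) (at t within {0..}))"
  by (simp add: lorenz_solution_def lorenz_field_def)

text \<open>Outside a large ball the radial component of the field points inwards. So the field cut off
  outside that ball is globally Lipschitz, and its solutions do not see the cut-off.\<close>

lemma lorenz_solution_exists:
  assumes "\<alpha> \<ge> 1" "b \<ge> 1" "r \<ge> 0"
  shows "\<exists>u. lorenz_solution \<alpha> b r u \<and> u 0 = u\<^sub>0"
proof -
  define R where "R = max (norm u\<^sub>0) (b * (r + \<alpha>))"
  define \<rho> where "\<rho> = closest_point (cball (0 :: real^3) R)"
  define G where "G x = lorenz_field \<alpha> b r (\<rho> x)" for x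
  have R: "0 < R" "b * (r + \<alpha>) \<le> R" "norm u\<^sub>0 \<le> R"
    using assms by (auto simp: R_def less_max_iff_disj)
  have \<rho>: "1-lipschitz_on UNIV \<rho>"
    unfolding \<rho>_def using R(1) by (intro lipschitz_onI) (auto intro!: closest_point_lipschitz)
  have \<rho>_range: "range \<rho> \<subseteq> cball 0 R"
    unfolding \<rho>_def using R(1) by (intro image_subsetI closest_point_in_set) auto
  obtain L where "L-lipschitz_on (cball 0 R) (lorenz_field \<alpha> b r)"
    using lorenz_field_lipschitz_on_cball R(1) less_imp_le by blast
  then have "(L * 1)-lipschitz_on UNIV G"
    unfolding G_def using \<rho> \<rho>_range by (intro lipschitz_on_compose2) (auto intro: lipschitz_on_subset)
  then obtain u where u: "u 0 = u\<^sub>0"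
      "\<And>t. 0 \<le> t \<Longrightarrow> (u has_vector_derivative G (u t)) (at t within {0..})"
    using lipschitz_ode_global_solution by blast
  have "norm (u t) \<le> R" if "0 \<le> t" for t
  proof (rule cball_positively_invariant[OF u(2)])
    fix s assume out: "R \<le> norm (u s)"
    have \<rho>_us: "\<rho> (u s) = (R / norm (u s)) *\<^sub>R u s"
      unfolding \<rho>_def using R(1) out by (rule closest_point_cball_scale)
    then have "norm (\<rho> (u s)) = R" using R(1) out by auto
    then have "\<rho> (u s) \<bullet> G (u s) \<le> 0"
      unfolding G_def using R assms by (intro inner_lorenz_field_nonpos) auto
    then show "u s \<bullet> G (u s) \<le> 0"
      using R(1) out by (auto simp: \<rho>_us mult_le_0_iff divide_le_0_iff)
  qed (use u R that in auto)
  then have "G (u t) = lorenz_field \<alpha> b r (u t)" if "0 \<le> t" for t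
    using that by (simp add: G_def \<rho>_def closest_point_self)
  then show ?thesis
    using u by (metis lorenz_solution_iff)
qed

section \<open>Solutions of the Lorenz equation and their differences\<close>

lemma lorenz_solution_component_deriv:
  assumes "lorenz_solution \<alpha> b r u" "0 \<le> t"
  shows "((\<lambda>t. u t $ i) has_real_derivative lorenz_field \<alpha> b r (u t) $ i) (at t within {0..})"
  using bounded_linear.has_vector_derivative[OF bounded_linear_vec_nth, of u _ _ i] assms
  unfolding lorenz_solution_iff has_real_derivative_iff_has_vector_derivative by blast

lemma lorenz_solution_continuous_on:
  assumes "lorenz_solution \<alpha> b r u"
  shows "continuous_on {0..} u"
  using assms unfolding lorenz_solution_iff
  by (meson atLeast_iff continuous_on_eq_continuous_within has_vector_derivative_continuous)

text \<open>The equation is autonomous. This restarts the reference solution at an observation time,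
  so that each forecast can be compared with it from time 0.\<close>

lemma lorenz_solution_shift:
  assumes "lorenz_solution \<alpha> b r u" "0 \<le> c"
  shows "lorenz_solution \<alpha> b r (\<lambda>t. u (c + t))"
  unfolding lorenz_solution_iff
proof (intro allI impI)
  fix t :: real assume t: "0 \<le> t"
  have "((u \<circ> (+) c) has_vector_derivative 1 *\<^sub>R lorenz_field \<alpha> b r (u (c + t))) (at t within {0..})"
  proof (rule vector_diff_chain_within)
    show "((+) c has_vector_derivative 1) (at t within {0..})"
      by (auto intro!: derivative_eq_intros simp flip: has_real_derivative_iff_has_vector_derivative)
    have "(u has_vector_derivative lorenz_field \<alpha> b r (u (c + t))) (at (c + t) within {0..})"
      using assms t by (simp add: lorenz_solution_iff)
    then show "(u has_vector_derivative lorenz_field \<alpha> b r (u (c + t)))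
        (at (c + t) within (+) c ` {0..})"
      by (rule has_vector_derivative_within_subset) (use assms in auto)
  qed
  then show "((\<lambda>t. u (c + t)) has_vector_derivative lorenz_field \<alpha> b r (u (c + t))) (at t within {0..})"
    by (simp add: o_def)
qed

lemma abs_mult_le_half_sum_squares: "\<bar>x * y\<bar> \<le> (x\<^sup>2 + y\<^sup>2) / 2" for x y :: real
  using sum_squares_bound[of "\<bar>x\<bar>" "\<bar>y\<bar>"] by (simp add: abs_mult)

text \<open>In the energy balance the coefficients come from \<open>v\<close> alone, so a bound on
  \<open>v\<close> yields a linear differential inequality. Equal initial values give uniqueness;
  otherwise it gives continuous dependence at \<open>v 0\<close>.\<close>

lemma lorenz_solution_diff_growth:
  assumes "0 \<le> \<alpha>" "0 \<le> b" "0 \<le> T"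
    and u: "lorenz_solution \<alpha> b r u" and v: "lorenz_solution \<alpha> b r v"
    and K: "\<And>s. 0 \<le> s \<Longrightarrow> s \<le> T \<Longrightarrow> norm (v s) \<le> K"
  shows "(norm (u T - v T))\<^sup>2 \<le> exp (2 * K * T) * (norm (u 0 - v 0))\<^sup>2"
  unfolding norm_sq_3 vector_minus_component
proof (rule gronwall_forward[OF \<open>0 \<le> T\<close>])
  fix t :: real assume t: "0 \<le> t"
  show "((\<lambda>t. (u t $ 1 - v t $ 1)\<^sup>2 + (u t $ 2 - v t $ 2)\<^sup>2 + (u t $ 3 - v t $ 3)\<^sup>2) has_real_derivative
    2 * ((u t $ 1 - v t $ 1) * (lorenz_field \<alpha> b r (u t) $ 1 - lorenz_field \<alpha> b r (v t) $ 1)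
      + (u t $ 2 - v t $ 2) * (lorenz_field \<alpha> b r (u t) $ 2 - lorenz_field \<alpha> b r (v t) $ 2)
      + (u t $ 3 - v t $ 3) * (lorenz_field \<alpha> b r (u t) $ 3 - lorenz_field \<alpha> b r (v t) $ 3)))
    (at t within {0..})"
    by (auto intro!: derivative_eq_intros lorenz_solution_component_deriv[OF u t]
        lorenz_solution_component_deriv[OF v t] simp: algebra_simps)
next
  fix t :: real assume t: "0 < t" "t < T"
  obtain x y z where xyz: "u t $ 1 = v t $ 1 + x" "u t $ 2 = v t $ 2 + y" "u t $ 3 = v t $ 3 + z"
    by (metis add.commute diff_add_cancel)
  have vK: "\<bar>v t $ i\<bar> \<le> K" for i
    using K[of t] t component_le_norm_cart[of "v t" i] by auto
  then have K0: "0 \<le> K" by (rule order_trans[OF abs_ge_zero])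
  \<comment> \<open>The terms cubic in the difference, the cross terms with \<open>\<alpha>\<close>
    and the terms with \<open>v t $ 1\<close> cancel between the components.\<close>
  have "(u t $ 1 - v t $ 1) * (lorenz_field \<alpha> b r (u t) $ 1 - lorenz_field \<alpha> b r (v t) $ 1)
      + (u t $ 2 - v t $ 2) * (lorenz_field \<alpha> b r (u t) $ 2 - lorenz_field \<alpha> b r (v t) $ 2)
      + (u t $ 3 - v t $ 3) * (lorenz_field \<alpha> b r (u t) $ 3 - lorenz_field \<alpha> b r (v t) $ 3)
      = - \<alpha> * x\<^sup>2 - y\<^sup>2 - b * z\<^sup>2 - v t $ 3 * (x * y) + v t $ 2 * (x * z)"
    unfolding lorenz_field_component xyz by (simp add: power2_eq_square algebra_simps)
  also have "\<dots> \<le> K * ((x\<^sup>2 + y\<^sup>2) / 2) + K * ((x\<^sup>2 + z\<^sup>2) / 2)"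
  proof -
    have "- (v t $ 3 * (x * y)) \<le> K * ((x\<^sup>2 + y\<^sup>2) / 2)"
      by (rule order_trans[OF abs_ge_minus_self])
        (unfold abs_mult[of "v t $ 3"], intro mult_mono vK abs_mult_le_half_sum_squares K0 abs_ge_zero)
    moreover have "v t $ 2 * (x * z) \<le> K * ((x\<^sup>2 + z\<^sup>2) / 2)"
      by (rule order_trans[OF abs_ge_self])
        (unfold abs_mult[of "v t $ 2"], intro mult_mono vK abs_mult_le_half_sum_squares K0 abs_ge_zero)
    moreover have "0 \<le> \<alpha> * x\<^sup>2" "0 \<le> b * z\<^sup>2" "0 \<le> y\<^sup>2" using assms by auto
    ultimately show ?thesis by linarith
  qed
  also have "\<dots> \<le> K * (x\<^sup>2 + y\<^sup>2 + z\<^sup>2)"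
    using mult_nonneg_nonneg[OF K0 zero_le_power2[of y]] mult_nonneg_nonneg[OF K0 zero_le_power2[of z]]
    by (simp add: field_simps)
  finally show "2 * ((u t $ 1 - v t $ 1) * (lorenz_field \<alpha> b r (u t) $ 1 - lorenz_field \<alpha> b r (v t) $ 1)
      + (u t $ 2 - v t $ 2) * (lorenz_field \<alpha> b r (u t) $ 2 - lorenz_field \<alpha> b r (v t) $ 2)
      + (u t $ 3 - v t $ 3) * (lorenz_field \<alpha> b r (u t) $ 3 - lorenz_field \<alpha> b r (v t) $ 3))
    \<le> 2 * K * ((u t $ 1 - v t $ 1)\<^sup>2 + (u t $ 2 - v t $ 2)\<^sup>2 + (u t $ 3 - v t $ 3)\<^sup>2)"
    by (simp add: xyz)
qed

lemma lorenz_solution_locally_bounded: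
  assumes "lorenz_solution \<alpha> b r v"
  obtains K where "\<And>s. 0 \<le> s \<Longrightarrow> s \<le> T \<Longrightarrow> norm (v s) \<le> K"
proof -
  have "compact (v ` {0..T})"
    using lorenz_solution_continuous_on[OF assms]
    by (intro compact_continuous_image) (auto intro: continuous_on_subset)
  then have "bounded (v ` {0..T})" by (rule compact_imp_bounded)
  then obtain K where "\<forall>x\<in>v ` {0..T}. norm x \<le> K" unfolding bounded_iff ..
  then show ?thesis
    by (intro that[of K]) auto
qed

text \<open>The growth estimate with zero initial difference makes the value at time
  \<open>t\<close> unique, so the definite description denotes it.\<close>

lemma lorenz_flow_eq:
  assumes "0 \<le> \<alpha>" "0 \<le> b" "0 \<le> t" and u: "lorenz_solution \<alpha> b r u"
  shows "lorenz_flow \<alpha> b r t (u 0) = u t"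
  unfolding lorenz_flow_def
proof (rule the_equality)
  fix w assume "\<exists>u'. lorenz_solution \<alpha> b r u' \<and> u' 0 = u 0 \<and> u' t = w"
  then obtain u' where u': "lorenz_solution \<alpha> b r u'" "u' 0 = u 0" "u' t = w" by blast
  obtain K where "\<And>s. 0 \<le> s \<Longrightarrow> s \<le> t \<Longrightarrow> norm (u s) \<le> K"
    using lorenz_solution_locally_bounded[OF u] by blast
  from lorenz_solution_diff_growth[OF assms(1-3) u'(1) u this] u' show "w = u t" by simp
qed (use u in blast)

text \<open>Serves the measurability of the filter. The bound \<open>K\<close> depends on the
  solution through \<open>m\<close>, which still gives continuity at each \<open>m\<close>.\<close>

lemma continuous_on_lorenz_flow:
  assumes "\<alpha> \<ge> 1" "b \<ge> 1" "r \<ge> 0" "0 \<le> t"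
  shows "continuous_on UNIV (lorenz_flow \<alpha> b r t)"
  unfolding continuous_on_eq_continuous_within continuous_within
proof (intro ballI)
  fix m :: "real^3"
  obtain v where v: "lorenz_solution \<alpha> b r v" "v 0 = m"
    using lorenz_solution_exists[OF assms(1-3)] by blast
  obtain K where K: "\<And>s. 0 \<le> s \<Longrightarrow> s \<le> t \<Longrightarrow> norm (v s) \<le> K"
    using lorenz_solution_locally_bounded[OF v(1)] by blast
  have bound: "norm (lorenz_flow \<alpha> b r t m' - lorenz_flow \<alpha> b r t m) \<le> exp (K * t) * norm (m' - m)"
    for m'
  proof -
    obtain u where u: "lorenz_solution \<alpha> b r u" "u 0 = m'"
      using lorenz_solution_exists[OF assms(1-3)] by blast
    have "(norm (u t - v t))\<^sup>2 \<le> exp (2 * K * t) * (norm (u 0 - v 0))\<^sup>2"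
      using assms u v K by (intro lorenz_solution_diff_growth) auto
    also have "\<dots> = (exp (K * t) * norm (u 0 - v 0))\<^sup>2"
      by (simp add: power_mult_distrib mult.assoc flip: exp_double)
    finally have "norm (u t - v t) \<le> exp (K * t) * norm (u 0 - v 0)"
      by (rule power2_le_imp_le) auto
    then show ?thesis
      using lorenz_flow_eq[OF _ _ _ u(1), of t] lorenz_flow_eq[OF _ _ _ v(1), of t] u v assms by simp
  qed
  have "((\<lambda>m'. exp (K * t) * norm (m' - m)) \<longlongrightarrow> exp (K * t) * norm (m - m)) (at m)"
    by (intro tendsto_intros)
  then have "((\<lambda>m'. lorenz_flow \<alpha> b r t m' - lorenz_flow \<alpha> b r t m) \<longlongrightarrow> 0) (at m)"
    by (intro Lim_null_comparison[OF always_eventually[OF allI[OF bound]]]) simp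
  then show "(lorenz_flow \<alpha> b r t \<longlongrightarrow> lorenz_flow \<alpha> b r t m) (at m)"
    by (rule Lim_null[THEN iffD2])
qed

text \<open>Invariance keeps \<open>v\<close> in the compact attractor. Here \<open>K\<close> bounds
  the norm, not its square, and is not explicit.\<close>

lemma lorenz_solution_bounded_on_attractor:
  assumes "0 \<le> \<alpha>" "0 \<le> b" "is_global_attractor (lorenz_flow \<alpha> b r) \<A>"
    and v: "lorenz_solution \<alpha> b r v" "v 0 \<in> \<A>"
  obtains K where "\<And>t. 0 \<le> t \<Longrightarrow> norm (v t) \<le> K"
proof -
  have "v t \<in> \<A>" if "0 \<le> t" for t
    using assms that lorenz_flow_eq[OF assms(1,2) that v(1)]
    unfolding is_global_attractor_def by (metis imageI)
  moreover have "bounded \<A>"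
    using assms(3) by (simp add: is_global_attractor_def compact_imp_bounded)
  ultimately show ?thesis using that by (auto simp: bounded_iff)
qed

section \<open>Contraction of the forecast step\<close>

lemma sq_norm_eq: "sq_norm u = 2 * (u$1)\<^sup>2 + (u$2)\<^sup>2 + (u$3)\<^sup>2"
  by (simp add: sq_norm_def norm_sq_3 proj_P_def matrix_vector_mult_def sum_3)

text \<open>Turns exponential decay into a linear factor: \<open>1 / (1 + x) \<le> 1 - x / 2\<close>
  amounts to \<open>x\<^sup>2 \<le> x\<close>.\<close>

lemma exp_minus_le:
  fixes x :: real
  assumes "0 \<le> x" "x \<le> 1"
  shows "exp (- x) \<le> 1 - x / 2"
proof -
  have "exp (- x) \<le> 1 / (1 + x)"
    using exp_ge_add_one_self[of x] assms
    by (simp add: exp_minus inverse_eq_divide frac_le)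
  also have "\<dots> \<le> 1 - x / 2"
  proof -
    have "x * x \<le> x * 1" using assms by (intro mult_left_mono) auto
    then show ?thesis using assms by (simp add: divide_simps) (simp add: algebra_simps)
  qed
  finally show ?thesis .
qed

lemma weighted_sum_squares_deriv:
  fixes X Y Z :: "real \<Rightarrow> real"
  assumes "(X has_real_derivative X') (at t within S)" "(Y has_real_derivative Y') (at t within S)"
    "(Z has_real_derivative Z') (at t within S)"
  shows "((\<lambda>t. (2 - D * t) * (X t)\<^sup>2 + (Y t)\<^sup>2 + (Z t)\<^sup>2) has_real_derivative
    (2 - D * t) * (2 * X t * X') - D * (X t)\<^sup>2 + 2 * Y t * Y' + 2 * Z t * Z') (at t within S)"
  by (rule derivative_eq_intros assms refl)+ simp

text \<open>The weight of the observed component starts at \<open>2\<close>, its weight in \<open>sq_norm\<close>, and decreases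
  at the rate \<open>D\<close>. This decrease absorbs every term of the energy balance that involves the
  observed component.\<close>

lemma lorenz_weighted_energy_decay:
  fixes \<alpha> K :: real
  defines "D \<equiv> 10 * (\<alpha> + K)\<^sup>2 + 1"
  assumes "0 \<le> \<alpha>" "1 \<le> b" "0 \<le> h" "D * h \<le> 1"
    and u: "lorenz_solution \<alpha> b r u" and v: "lorenz_solution \<alpha> b r v"
    and K: "\<And>t. 0 \<le> t \<Longrightarrow> norm (v t) \<le> K"
  shows "(2 - D * h) * (u h $ 1 - v h $ 1)\<^sup>2 + (u h $ 2 - v h $ 2)\<^sup>2 + (u h $ 3 - v h $ 3)\<^sup>2
    \<le> exp (- h / 2) * sq_norm (u 0 - v 0)"
proof -
  let ?F = "\<lambda>t. (2 - D * t) * (u t $ 1 - v t $ 1)\<^sup>2 + (u t $ 2 - v t $ 2)\<^sup>2 + (u t $ 3 - v t $ 3)\<^sup>2"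
  let ?d = "\<lambda>t i. lorenz_field \<alpha> b r (u t) $ i - lorenz_field \<alpha> b r (v t) $ i"
  let ?F' = "\<lambda>t. (2 - D * t) * (2 * (u t $ 1 - v t $ 1) * ?d t 1) - D * (u t $ 1 - v t $ 1)\<^sup>2
    + 2 * (u t $ 2 - v t $ 2) * ?d t 2 + 2 * (u t $ 3 - v t $ 3) * ?d t 3"
  have "?F h \<le> exp (- (1 / 2) * h) * ?F 0"
  proof (rule gronwall_forward[OF \<open>0 \<le> h\<close>])
    fix t :: real assume t: "0 \<le> t"
    show "(?F has_real_derivative ?F' t) (at t within {0..})"
      by (intro weighted_sum_squares_deriv DERIV_diff lorenz_solution_component_deriv u v t)
  next
    fix t :: real assume t: "0 < t" "t < h"
    obtain x y z where xyz: "u t $ 1 = v t $ 1 + x" "u t $ 2 = v t $ 2 + y" "u t $ 3 = v t $ 3 + z"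
      by (metis add.commute diff_add_cancel)
    have vK: "\<bar>v t $ i\<bar> \<le> K" for i
      using K[of t] t component_le_norm_cart[of "v t" i] by auto
    then have K0: "0 \<le> K" by (rule order_trans[OF abs_ge_zero])
    define g where "g = 2 - D * t"
    have D: "1 \<le> D" by (simp add: D_def)
    have "D * t \<le> D * h" "0 \<le> D * t" using t D by (auto intro!: mult_left_mono)
    then have g: "0 \<le> g" "g \<le> 2" using \<open>D * h \<le> 1\<close> unfolding g_def by linarith+
    \<comment> \<open>The cubic terms cancel again, since \<open>y\<close> and \<open>z\<close>
      carry equal weights; the cross terms with \<open>\<alpha>\<close> survive because
      \<open>x\<close> is weighted by \<open>g\<close>.\<close>
    have "?F' t = g * (2 * \<alpha> * (x * y)) - g * (2 * \<alpha> * x\<^sup>2) - D * x\<^sup>2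
        + - 2 * ((\<alpha> + v t $ 3) * (x * y)) - 2 * y\<^sup>2 - 2 * (b * z\<^sup>2) + 2 * (v t $ 2 * (x * z))"
      unfolding lorenz_field_component xyz g_def[symmetric] by (simp add: power2_eq_square algebra_simps)
    \<comment> \<open>Each cross term is split so that it costs only half of
      \<open>y\<^sup>2\<close> or \<open>z\<^sup>2\<close>, the rest being charged to
      \<open>x\<^sup>2\<close>. Of the damping \<open>2 * y\<^sup>2\<close> and
      \<open>2 * z\<^sup>2\<close> at least one square of each is left, more than the decay rate
      asks for.\<close>
    moreover have "g * (2 * \<alpha> * (x * y)) \<le> 8 * \<alpha>\<^sup>2 * x\<^sup>2 + y\<^sup>2 / 2"
    proof -
      have "g * (2 * \<alpha> * (x * y)) \<le> \<bar>g\<bar> * \<bar>2 * \<alpha> * (x * y)\<bar>"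
        unfolding abs_mult[symmetric] by (rule abs_ge_self)
      also have "\<dots> \<le> 2 * \<bar>2 * \<alpha> * (x * y)\<bar>"
        using g by (intro mult_right_mono) auto
      also have "\<dots> = \<bar>(4 * \<alpha> * x) * y\<bar>" by (simp add: abs_mult)
      also have "\<dots> \<le> 8 * \<alpha>\<^sup>2 * x\<^sup>2 + y\<^sup>2 / 2"
        using abs_mult_le_half_sum_squares[of "4 * \<alpha> * x" y]
        unfolding power_mult_distrib by simp
      finally show ?thesis .
    qed
    moreover have "- 2 * ((\<alpha> + v t $ 3) * (x * y)) \<le> 2 * (\<alpha> + K)\<^sup>2 * x\<^sup>2 + y\<^sup>2 / 2"
    proof -
      have "- 2 * ((\<alpha> + v t $ 3) * (x * y)) \<le> 2 * \<bar>(\<alpha> + v t $ 3) * (x * y)\<bar>" by linarith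
      also have "\<dots> \<le> 2 * ((\<alpha> + K) * \<bar>x * y\<bar>)"
        unfolding abs_mult[of "\<alpha> + v t $ 3"] using vK[of 3] \<open>0 \<le> \<alpha>\<close>
        by (intro mult_left_mono mult_right_mono) auto
      also have "\<dots> = \<bar>(2 * (\<alpha> + K) * x) * y\<bar>" using K0 \<open>0 \<le> \<alpha>\<close> by (simp add: abs_mult)
      also have "\<dots> \<le> 2 * (\<alpha> + K)\<^sup>2 * x\<^sup>2 + y\<^sup>2 / 2"
        using abs_mult_le_half_sum_squares[of "2 * (\<alpha> + K) * x" y]
        unfolding power_mult_distrib by simp
      finally show ?thesis .
    qed
    moreover have "2 * (v t $ 2 * (x * z)) \<le> 2 * K\<^sup>2 * x\<^sup>2 + z\<^sup>2 / 2"
    proof -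
      have "2 * (v t $ 2 * (x * z)) \<le> 2 * \<bar>v t $ 2 * (x * z)\<bar>" by linarith
      also have "\<dots> \<le> 2 * (K * \<bar>x * z\<bar>)"
        unfolding abs_mult[of "v t $ 2"] using vK[of 2]
        by (intro mult_left_mono mult_right_mono) auto
      also have "\<dots> = \<bar>(2 * K * x) * z\<bar>" using K0 by (simp add: abs_mult)
      also have "\<dots> \<le> 2 * K\<^sup>2 * x\<^sup>2 + z\<^sup>2 / 2"
        using abs_mult_le_half_sum_squares[of "2 * K * x" z]
        unfolding power_mult_distrib by simp
      finally show ?thesis .
    qed
    \<comment> \<open>This fixes \<open>D\<close>: the first two terms are at most
      \<open>8 * (\<alpha> + K)\<^sup>2\<close>, the third adds 2 more, and the final 1 leaves an
      \<open>x\<^sup>2\<close> that pays for decay of the weighted term, as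
      \<open>g \<le> 2\<close>.\<close>
    moreover have "8 * \<alpha>\<^sup>2 * x\<^sup>2 + 2 * K\<^sup>2 * x\<^sup>2 + 2 * (\<alpha> + K)\<^sup>2 * x\<^sup>2 + x\<^sup>2 \<le> D * x\<^sup>2"
    proof -
      have "8 * \<alpha>\<^sup>2 + 2 * K\<^sup>2 + 2 * (\<alpha> + K)\<^sup>2 + 1 \<le> D"
        using K0 \<open>0 \<le> \<alpha>\<close> by (simp add: D_def power2_sum)
      from mult_right_mono[OF this zero_le_power2[of x]] show ?thesis by (simp add: algebra_simps)
    qed
    moreover have "0 \<le> g * (2 * \<alpha> * x\<^sup>2)" using g \<open>0 \<le> \<alpha>\<close> by simp
    moreover have "z\<^sup>2 \<le> b * z\<^sup>2" using \<open>1 \<le> b\<close> by (simp add: mult_le_cancel_right1)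
    moreover have "g * x\<^sup>2 \<le> 2 * x\<^sup>2" using g by (intro mult_right_mono) auto
    \<comment> \<open>With every nonlinear term replaced by a variable, the estimates combine by
      linear arithmetic.\<close>
    moreover have "lhs \<le> - (1 / 2) * (gx + y2 + z2)"
      if "lhs = p1 - p2 - Dx + p3 - 2 * y2 - 2 * bz + p4" "p1 \<le> c1 + y2 / 2" "p3 \<le> c3 + y2 / 2"
        "p4 \<le> c4 + z2 / 2" "c1 + c4 + c3 + x2 \<le> Dx" "0 \<le> p2" "z2 \<le> bz" "gx \<le> 2 * x2"
        "0 \<le> y2" "0 \<le> z2" for lhs p1 p2 p3 p4 Dx bz c1 c3 c4 gx x2 y2 z2 :: real
      using that by argo
    ultimately have "?F' t \<le> - (1 / 2) * (g * x\<^sup>2 + y\<^sup>2 + z\<^sup>2)"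
      using zero_le_power2[of y] zero_le_power2[of z] by blast
    then show "?F' t \<le> - (1 / 2) * ?F t"
      unfolding xyz g_def by simp
  qed
  then show ?thesis by (simp add: sq_norm_eq)
qed

lemma lorenz_forecast_contraction:
  assumes "1 \<le> \<alpha>" "1 \<le> b" "0 \<le> r" "0 \<le> h" "h \<le> 1" "(10 * (\<alpha> + K)\<^sup>2 + 1) * h \<le> 1" "0 \<le> s"
    and v: "lorenz_solution \<alpha> b r v"
    and K: "\<And>t. 0 \<le> t \<Longrightarrow> norm (v t) \<le> K"
  shows "(norm (lorenz_flow \<alpha> b r h m - v (s + h)))\<^sup>2 \<le> (1 - h / 4) * sq_norm (m - v s)"
proof -
  obtain u where u: "lorenz_solution \<alpha> b r u" "u 0 = m"
    using lorenz_solution_exists assms by blast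
  define w where "w t = v (s + t)" for t
  have w: "lorenz_solution \<alpha> b r w"
    unfolding w_def by (intro lorenz_solution_shift v assms)
  have wK: "norm (w t) \<le> K" if "0 \<le> t" for t
    unfolding w_def using that assms by (intro K) auto
  define D where "D = 10 * (\<alpha> + K)\<^sup>2 + 1"
  have flow: "lorenz_flow \<alpha> b r h m = u h"
    using lorenz_flow_eq[OF _ _ _ u(1), of h] u assms by simp
  have "(norm (u h - w h))\<^sup>2
      \<le> (2 - D * h) * (u h $ 1 - w h $ 1)\<^sup>2 + (u h $ 2 - w h $ 2)\<^sup>2 + (u h $ 3 - w h $ 3)\<^sup>2"
  proof -
    \<comment> \<open>By \<open>D * h \<le> 1\<close> the final weight is at least 1, so the
      weighted energy dominates the Euclidean norm.\<close>
    have "1 * (u h $ 1 - w h $ 1)\<^sup>2 \<le> (2 - D * h) * (u h $ 1 - w h $ 1)\<^sup>2"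
      using assms(6) unfolding D_def by (intro mult_right_mono) auto
    then show ?thesis by (simp add: norm_sq_3)
  qed
  also have "\<dots> \<le> exp (- h / 2) * sq_norm (u 0 - w 0)"
    unfolding D_def by (rule lorenz_weighted_energy_decay[OF _ _ _ _ u(1) w wK]) (use assms(1-6) in simp_all)
  also have "\<dots> \<le> (1 - h / 4) * sq_norm (u 0 - w 0)"
    using exp_minus_le[of "h / 2"] assms(4,5) by (intro mult_right_mono) (auto simp: sq_norm_eq)
  finally show ?thesis by (simp add: flow u w_def)
qed

section \<open>The filter with Gaussian noise\<close>

text \<open>The affine map has the fixed point \<open>d / c\<close>, and the distance to it shrinks
  by \<open>1 - c\<close> per step; \<open>?G\<close> is the exact orbit from \<open>E 0\<close>.
  The bound \<open>c \<le> 1\<close> makes the map monotone, as the induction requires.\<close>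

lemma limsup_le_of_affine_recursion:
  fixes E :: "nat \<Rightarrow> real"
  assumes rec: "\<And>k. E (Suc k) \<le> (1 - c) * E k + d" and c: "0 < c" "c \<le> 1"
  shows "limsup (\<lambda>k. ereal (E k)) \<le> ereal (d / c)"
proof -
  let ?G = "\<lambda>k. (1 - c) ^ k * (E 0 - d / c) + d / c"
  have le: "E k \<le> ?G k" for k
  proof (induction k)
    case (Suc k)
    have "E (Suc k) \<le> (1 - c) * E k + d" by (rule rec)
    also have "\<dots> \<le> (1 - c) * ?G k + d" using Suc c by (intro add_right_mono mult_left_mono) auto
    also have "\<dots> = ?G (Suc k)" using c by (simp add: field_simps)
    finally show ?case .
  qed simp
  have "?G \<longlonglongrightarrow> 0 * (E 0 - d / c) + d / c"
    using c by (intro tendsto_intros LIMSEQ_power_zero) auto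
  then have "limsup (\<lambda>k. ereal (?G k)) = ereal (d / c)"
    by (intro lim_imp_Limsup) auto
  moreover have "limsup (\<lambda>k. ereal (E k)) \<le> limsup (\<lambda>k. ereal (?G k))"
    by (intro Limsup_mono always_eventually allI) (use le in simp)
  ultimately show ?thesis by simp
qed

section \<open>Second moments and independence of the noise\<close>

context prob_space
begin

lemma standard_normal_distributed_integrable:
  assumes D: "distributed M lborel X std_normal_density"
  shows "integrable M X" "integrable M (\<lambda>x. (X x)\<^sup>2)" "expectation (\<lambda>x. (X x)\<^sup>2) = 1"
proof -
  show "integrable M X"
    using distributed_integrable[OF D, of "\<lambda>x. x"] integrable_std_normal_moment[of 1] by simp
  show "integrable M (\<lambda>x. (X x)\<^sup>2)"
    using distributed_integrable[OF D, of "\<lambda>x. x\<^sup>2"] integrable_std_normal_moment[of 2] by simp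
  show "expectation (\<lambda>x. (X x)\<^sup>2) = 1"
    using standard_normal_distributed_variance[OF D] standard_normal_distributed_expectation[OF D]
    by simp
qed

text \<open>The cross term is a product of independent variables, one of mean zero. Square
  integrability on a probability space makes \<open>X\<close> integrable, so that the product rule
  applies.\<close>

lemma expectation_sq_add_indep_standard_normal:
  fixes X Z :: "'a \<Rightarrow> real"
  assumes ind: "indep_var borel X borel Z" and X2: "integrable M (\<lambda>x. (X x)\<^sup>2)"
    and Z: "distributed M lborel Z std_normal_density"
  shows "integrable M (\<lambda>x. (p * X x + c * Z x)\<^sup>2)"
    and "expectation (\<lambda>x. (p * X x + c * Z x)\<^sup>2) = p\<^sup>2 * expectation (\<lambda>x. (X x)\<^sup>2) + c\<^sup>2"
proof -
  note Z' = standard_normal_distributed_integrable[OF Z]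
  have X: "integrable M X"
    using square_integrable_imp_integrable[OF indep_var_rv1[OF ind] X2] .
  have XZ: "integrable M (\<lambda>x. X x * Z x)" "expectation (\<lambda>x. X x * Z x) = 0"
    using indep_var_integrable[OF ind X Z'(1)] indep_var_lebesgue_integral[OF ind X Z'(1)]
      standard_normal_distributed_expectation[OF Z] by auto
  have eq: "(\<lambda>x. (p * X x + c * Z x)\<^sup>2)
      = (\<lambda>x. p\<^sup>2 * (X x)\<^sup>2 + 2 * p * c * (X x * Z x) + c\<^sup>2 * (Z x)\<^sup>2)"
    by (simp add: power2_eq_square algebra_simps)
  show "integrable M (\<lambda>x. (p * X x + c * Z x)\<^sup>2)"
    unfolding eq using XZ Z' X2 by (intro Bochner_Integration.integrable_add integrable_mult_right)
  show "expectation (\<lambda>x. (p * X x + c * Z x)\<^sup>2) = p\<^sup>2 * expectation (\<lambda>x. (X x)\<^sup>2) + c\<^sup>2"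
    unfolding eq using XZ Z' X2 by simp
qed

text \<open>Subfamilies over the disjoint index sets \<open>{1..k}\<close> and
  \<open>{Suc k}\<close> are independent. Measurability refers to restricted sequences, while
  \<open>F\<close> is applied to the full one; the congruence assumption bridges the two.\<close>

lemma indep_var_of_past:
  fixes X :: "nat \<Rightarrow> 'a \<Rightarrow> real"
  assumes ind: "indep_vars (\<lambda>_. borel) X {1..}"
    and F: "F \<in> borel_measurable (\<Pi>\<^sub>M i\<in>{1..k}. borel)"
    and cong: "\<And>f g. (\<And>i. i \<in> {1..k} \<Longrightarrow> f i = g i) \<Longrightarrow> F f = F g"
  shows "indep_var borel (\<lambda>x. F (\<lambda>i. X i x)) borel (X (Suc k))"
proof -
  have "indep_var borel (F \<circ> (\<lambda>x. restrict (\<lambda>i. X i x) {1..k}))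
      borel ((\<lambda>f. f (Suc k)) \<circ> (\<lambda>x. restrict (\<lambda>i. X i x) {Suc k}))"
    by (intro indep_var_compose[OF indep_var_restrict[OF ind]] F) auto
  moreover have "F \<circ> (\<lambda>x. restrict (\<lambda>i. X i x) {1..k}) = (\<lambda>x. F (\<lambda>i. X i x))"
    by (auto simp: fun_eq_iff intro!: cong)
  moreover have "(\<lambda>f. f (Suc k)) \<circ> (\<lambda>x. restrict (\<lambda>i. X i x) {Suc k}) = X (Suc k)"
    by auto
  ultimately show ?thesis by simp
qed

end

section \<open>The filter as a function of the noise\<close>

lemma three_dvar_cong:
  assumes "\<And>j. j \<in> {1..k} \<Longrightarrow> y j = y' j"
  shows "three_dvar \<eta> \<Psi> m\<^sub>0 y k = three_dvar \<eta> \<Psi> m\<^sub>0 y' k"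
  using assms by (induction k) auto

text \<open>The index set \<open>J\<close> stays fixed while \<open>k\<close> varies in the
  induction, so all stages are measurable on one product space.\<close>

lemma borel_measurable_three_dvar:
  assumes "\<Psi> \<in> borel_measurable borel" and "{1..k} \<subseteq> J"
  shows "(\<lambda>f. three_dvar \<eta> \<Psi> m\<^sub>0 (observation \<epsilon> v h f) k)
    \<in> borel_measurable (\<Pi>\<^sub>M i\<in>J. (borel :: real measure))"
  using \<open>{1..k} \<subseteq> J\<close>
proof (induction k)
  case (Suc k)
  let ?g = "(\<eta> / (1 + \<eta>)) *\<^sub>R proj_P + proj_Q"
  have "continuous_on UNIV ((*v) ?g)"
    by (intro linear_continuous_on matrix_vector_mul_bounded_linear)
  then have "(*v) ?g \<in> borel_measurable borel"
    by (rule borel_measurable_continuous_onI)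
  note [measurable] = this assms(1)
  have [measurable]: "(\<lambda>f. three_dvar \<eta> \<Psi> m\<^sub>0 (observation \<epsilon> v h f) k)
      \<in> borel_measurable (\<Pi>\<^sub>M i\<in>J. (borel :: real measure))"
    by (rule Suc.IH[OF order_trans[OF _ Suc.prems]]) auto
  have "Suc k \<in> J" using Suc.prems by auto
  then have [measurable]: "(\<lambda>f. f (Suc k)) \<in> borel_measurable (\<Pi>\<^sub>M i\<in>J. (borel :: real measure))"
    by (rule measurable_component_singleton)
  show ?case unfolding three_dvar.simps observation_def[of _ _ _ _ "Suc k"] by measurable
qed simp

text \<open>The gains \<open>\<eta> / (1 + \<eta>)\<close> and \<open>1 / (1 + \<eta>)\<close> sum
  to 1, so the true state drops out and the new error is affine in the forecast error
  \<open>e k\<close> and the fresh noise.\<close>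

lemma filter_error_Suc_component:
  fixes \<alpha> b r \<epsilon> \<eta> h :: real and v :: "real \<Rightarrow> real^3" and m\<^sub>0 :: "real^3" and \<xi> :: "nat \<Rightarrow> real"
  defines "e \<equiv> \<lambda>k. lorenz_flow \<alpha> b r h (three_dvar \<eta> (lorenz_flow \<alpha> b r h) m\<^sub>0
      (observation \<epsilon> v h \<xi>) k) - v (real k * h + h)"
  assumes "\<eta> > 0"
  shows "filter_error \<alpha> b r \<epsilon> \<eta> h v m\<^sub>0 \<xi> (Suc k) $ 1
      = \<eta> / (1 + \<eta>) * e k $ 1 + \<epsilon> / (1 + \<eta>) * \<xi> (Suc k)"
    and "filter_error \<alpha> b r \<epsilon> \<eta> h v m\<^sub>0 \<xi> (Suc k) $ 2 = e k $ 2"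
    and "filter_error \<alpha> b r \<epsilon> \<eta> h v m\<^sub>0 \<xi> (Suc k) $ 3 = e k $ 3"
proof -
  have Suc: "real (Suc k) * h = real k * h + h" by (simp add: algebra_simps)
  have affine: "\<eta> / (1 + \<eta>) * w + 1 / (1 + \<eta>) * (y + \<epsilon> * x) - y
      = \<eta> / (1 + \<eta>) * (w - y) + \<epsilon> / (1 + \<eta>) * x" for w x y
    using \<open>\<eta> > 0\<close> by (simp add: divide_simps) (simp add: algebra_simps)
  define w where "w = lorenz_flow \<alpha> b r h (three_dvar \<eta> (lorenz_flow \<alpha> b r h) m\<^sub>0 (observation \<epsilon> v h \<xi>) k)"
  define y where "y = v (real k * h + h)"
  have err: "filter_error \<alpha> b r \<epsilon> \<eta> h v m\<^sub>0 \<xi> (Suc k) = ((\<eta> / (1 + \<eta>)) *\<^sub>R proj_P + proj_Q) *v w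
      + (1 / (1 + \<eta>)) *\<^sub>R ((obs_H \<bullet> y + \<epsilon> * \<xi> (Suc k)) *\<^sub>R obs_H) - y"
    unfolding filter_error_def three_dvar.simps observation_def[of _ _ _ _ "Suc k"] Suc w_def y_def ..
  have e: "e k = w - y" by (simp add: e_def w_def y_def)
  have "filter_error \<alpha> b r \<epsilon> \<eta> h v m\<^sub>0 \<xi> (Suc k) $ 1
      = \<eta> / (1 + \<eta>) * w $ 1 + 1 / (1 + \<eta>) * (y $ 1 + \<epsilon> * \<xi> (Suc k)) - y $ 1"
    by (simp add: err proj_P_def proj_Q_def obs_H_def inner_vec_def matrix_vector_mult_def sum_3)
  then show "filter_error \<alpha> b r \<epsilon> \<eta> h v m\<^sub>0 \<xi> (Suc k) $ 1
      = \<eta> / (1 + \<eta>) * e k $ 1 + \<epsilon> / (1 + \<eta>) * \<xi> (Suc k)"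
    unfolding affine e by simp
  show "filter_error \<alpha> b r \<epsilon> \<eta> h v m\<^sub>0 \<xi> (Suc k) $ 2 = e k $ 2"
    "filter_error \<alpha> b r \<epsilon> \<eta> h v m\<^sub>0 \<xi> (Suc k) $ 3 = e k $ 3"
    by (simp_all add: err e proj_P_def proj_Q_def obs_H_def matrix_vector_mult_def sum_3)
qed

theorem theorem3p2:
  fixes \<alpha> b r \<epsilon> :: real
    and \<A> :: "(real^3) set"
    and v :: "real \<Rightarrow> real^3"
    and m\<^sub>0 :: "real^3"
    and M :: "'w measure"
    and \<xi> :: "nat \<Rightarrow> 'w \<Rightarrow> real"
  assumes "\<alpha> > 1" and "b > 1" and "r > 0" and "\<epsilon> > 0"
    and "is_global_attractor (lorenz_flow \<alpha> b r) \<A>"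
    and "lorenz_solution \<alpha> b r v" and "v 0 \<in> \<A>"
    and "prob_space M"
    and "prob_space.indep_vars M (\<lambda>_. borel) \<xi> {1..}"
    and "\<And>k. k \<ge> 1 \<Longrightarrow> distributed M lborel (\<xi> k) std_normal_density"
  shows "\<exists>h\<^sub>c>0. \<exists>\<mu>>0. \<exists>\<eta>\<^sub>0>0. \<forall>\<eta>\<in>{0<..<\<eta>\<^sub>0}. \<forall>h\<in>{0<..<h\<^sub>c}.
           (let E = (\<lambda>k. \<integral>\<omega>. sq_norm (filter_error \<alpha> b r \<epsilon> \<eta> h v m\<^sub>0 (\<lambda>j. \<xi> j \<omega>) k) \<partial>M) in
             (\<forall>k. integrable M (\<lambda>\<omega>. sq_norm (filter_error \<alpha> b r \<epsilon> \<eta> h v m\<^sub>0 (\<lambda>j. \<xi> j \<omega>) k))) \<and>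
             (\<forall>k. E (Suc k) \<le> (1 - \<mu> * h) * E k + 2 * \<epsilon>\<^sup>2) \<and>
             limsup (\<lambda>k. ereal (E k)) \<le> ereal (2 * \<epsilon>\<^sup>2 / (\<mu> * h)))"
proof -
  interpret prob_space M by fact
  obtain K where K: "\<And>t. 0 \<le> t \<Longrightarrow> norm (v t) \<le> K"
    using lorenz_solution_bounded_on_attractor[of \<alpha> b r \<A> v] assms by force
  define h\<^sub>c where "h\<^sub>c = 1 / (10 * (\<alpha> + K)\<^sup>2 + 1)"
  have D: "1 \<le> 10 * (\<alpha> + K)\<^sup>2 + 1" by simp
  have hc: "0 < h\<^sub>c" using D unfolding h\<^sub>c_def by (intro divide_pos_pos) linarith+
  \<comment> \<open>The witnesses: rate \<open>1 / 4\<close> from the forecast contraction,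
    \<open>\<eta> < 1\<close> to damp the observed error by at least a half, and
    \<open>h\<^sub>c\<close> as the reciprocal of the constant \<open>D\<close> of the energy
    estimate.\<close>
  have main: "let E = (\<lambda>k. \<integral>\<omega>. sq_norm (filter_error \<alpha> b r \<epsilon> \<eta> h v m\<^sub>0 (\<lambda>j. \<xi> j \<omega>) k) \<partial>M) in
      (\<forall>k. integrable M (\<lambda>\<omega>. sq_norm (filter_error \<alpha> b r \<epsilon> \<eta> h v m\<^sub>0 (\<lambda>j. \<xi> j \<omega>) k))) \<and>
      (\<forall>k. E (Suc k) \<le> (1 - 1 / 4 * h) * E k + 2 * \<epsilon>\<^sup>2) \<and>
      limsup (\<lambda>k. ereal (E k)) \<le> ereal (2 * \<epsilon>\<^sup>2 / (1 / 4 * h))"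
    if \<eta>: "0 < \<eta>" "\<eta> < 1" and h: "0 < h" "h < h\<^sub>c" for \<eta> h
  proof -
    define \<delta> where "\<delta> k \<omega> = filter_error \<alpha> b r \<epsilon> \<eta> h v m\<^sub>0 (\<lambda>j. \<xi> j \<omega>) k" for k \<omega>
    \<comment> \<open>The forecast error as a deterministic functional of the noise sequence, to
      separate measurability from independence; \<open>e\<close> evaluates it at the random
      noise.\<close>
    define \<Phi> where "\<Phi> k f = lorenz_flow \<alpha> b r h
        (three_dvar \<eta> (lorenz_flow \<alpha> b r h) m\<^sub>0 (observation \<epsilon> v h f) k) - v (real k * h + h)" for k f
    define e where "e k \<omega> = \<Phi> k (\<lambda>j. \<xi> j \<omega>)" for k \<omega>
    have Dh: "(10 * (\<alpha> + K)\<^sup>2 + 1) * h \<le> 1"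
    proof -
      have "(10 * (\<alpha> + K)\<^sup>2 + 1) * h \<le> (10 * (\<alpha> + K)\<^sup>2 + 1) * h\<^sub>c"
        using h D by (intro mult_left_mono) linarith+
      then show ?thesis using D by (simp add: h\<^sub>c_def)
    qed
    moreover have "1 * h \<le> (10 * (\<alpha> + K)\<^sup>2 + 1) * h"
      using D h by (intro mult_right_mono) auto
    ultimately have h1: "h \<le> 1" by linarith
    have \<delta>_Suc: "\<delta> (Suc k) \<omega> $ 1 = \<eta> / (1 + \<eta>) * e k \<omega> $ 1 + \<epsilon> / (1 + \<eta>) * \<xi> (Suc k) \<omega>"
        "\<delta> (Suc k) \<omega> $ 2 = e k \<omega> $ 2" "\<delta> (Suc k) \<omega> $ 3 = e k \<omega> $ 3" for k \<omega>
      unfolding \<delta>_def e_def \<Phi>_def using filter_error_Suc_component[OF \<eta>(1)] by auto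
    have e_le: "(norm (e k \<omega>))\<^sup>2 \<le> (1 - h / 4) * sq_norm (\<delta> k \<omega>)" for k \<omega>
      unfolding e_def \<Phi>_def \<delta>_def filter_error_def
      using assms h h1 Dh K by (intro lorenz_forecast_contraction) auto
    have flow_meas: "lorenz_flow \<alpha> b r h \<in> borel_measurable borel"
      using assms h by (intro borel_measurable_continuous_onI continuous_on_lorenz_flow) auto
    have \<Phi>_meas: "\<Phi> k \<in> borel_measurable (\<Pi>\<^sub>M i\<in>J. borel)" if "{1..k} \<subseteq> J" for k J
      unfolding \<Phi>_def using flow_meas borel_measurable_three_dvar[OF flow_meas that]
      by (intro borel_measurable_diff measurable_compose[OF _ flow_meas]) auto
    have ind: "indep_var borel (\<lambda>\<omega>. e k \<omega> $ i) borel (\<xi> (Suc k))" for k i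
      unfolding e_def
    proof (rule indep_var_of_past[where F = "\<lambda>f. \<Phi> k f $ i"])
      show "(\<lambda>f. \<Phi> k f $ i) \<in> borel_measurable (\<Pi>\<^sub>M i\<in>{1..k}. borel)"
        by (rule measurable_compose[OF \<Phi>_meas]) auto
      show "\<Phi> k f $ i = \<Phi> k g $ i" if "\<And>i. i \<in> {1..k} \<Longrightarrow> f i = g i" for f g
        using that unfolding \<Phi>_def
        by (subst three_dvar_cong[of k _ "observation \<epsilon> v h g"]) (auto simp: observation_def)
    qed fact
    have e_meas: "(\<lambda>\<omega>. e k \<omega> $ i) \<in> borel_measurable M" for k i
      using indep_var_rv1[OF ind] .
    have normal: "distributed M lborel (\<xi> (Suc k)) std_normal_density" for k
      using assms(10) by simp
    \<comment> \<open>A non-integrable function would have integral 0 by default. The induction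
      alternates: the forecast bound dominates the components of \<open>e k\<close>, and adding
      independent noise gives \<open>\<delta> (Suc k)\<close>.\<close>
    have int: "integrable M (\<lambda>\<omega>. sq_norm (\<delta> k \<omega>))"
      and int_e: "integrable M (\<lambda>\<omega>. (e k \<omega> $ i)\<^sup>2)" for k i
    proof -
      have step: "integrable M (\<lambda>\<omega>. (e k \<omega> $ i)\<^sup>2)" if "integrable M (\<lambda>\<omega>. sq_norm (\<delta> k \<omega>))" for k i
      proof (rule Bochner_Integration.integrable_bound)
        show "integrable M (\<lambda>\<omega>. (1 - h / 4) * sq_norm (\<delta> k \<omega>))" using that by simp
        show "(\<lambda>\<omega>. (e k \<omega> $ i)\<^sup>2) \<in> borel_measurable M" using e_meas by simp
        have "(e k \<omega> $ i)\<^sup>2 \<le> (1 - h / 4) * sq_norm (\<delta> k \<omega>)" for \<omega>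
          using e_le component_le_norm_cart[of "e k \<omega>" i]
          by (metis abs_le_square_iff abs_norm_cancel order_trans)
        then show "AE \<omega> in M. norm ((e k \<omega> $ i)\<^sup>2) \<le> norm ((1 - h / 4) * sq_norm (\<delta> k \<omega>))"
          by (intro AE_I2) (metis abs_of_nonneg order_trans real_norm_def zero_le_power2)
      qed
      show "integrable M (\<lambda>\<omega>. sq_norm (\<delta> k \<omega>))"
      proof (induction k)
        case 0
        show ?case by (simp add: \<delta>_def filter_error_def)
      next
        case (Suc k)
        show ?case
          unfolding sq_norm_eq \<delta>_Suc
          by (intro Bochner_Integration.integrable_add integrable_mult_right
              expectation_sq_add_indep_standard_normal[OF ind _ normal] step Suc)
      qed
      from step[OF this] show "integrable M (\<lambda>\<omega>. (e k \<omega> $ i)\<^sup>2)" .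
    qed
    let ?E = "\<lambda>k. expectation (\<lambda>\<omega>. sq_norm (\<delta> k \<omega>))"
    have rec: "?E (Suc k) \<le> (1 - 1 / 4 * h) * ?E k + 2 * \<epsilon>\<^sup>2" for k
    proof -
      \<comment> \<open>Since \<open>p \<le> 1 / 2\<close>, the weight 2 of the first component is
        absorbed by \<open>2 * p\<^sup>2 \<le> 1\<close>; the same weight on the noise produces the
        additive constant \<open>2 * \<epsilon>\<^sup>2\<close>.\<close>
      define p c where "p = \<eta> / (1 + \<eta>)" and "c = \<epsilon> / (1 + \<eta>)"
      have "p\<^sup>2 \<le> (1 / 2)\<^sup>2"
        using \<eta> unfolding p_def by (intro power_mono) (auto simp: field_simps)
      then have gain: "2 * p\<^sup>2 \<le> 1" by (simp add: power_divide)
      have noise: "c\<^sup>2 \<le> \<epsilon>\<^sup>2"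
        using \<eta> assms(4) unfolding c_def by (intro power_mono) (auto simp: field_simps)
      note Z = expectation_sq_add_indep_standard_normal[OF ind int_e normal]
      have "?E (Suc k) = 2 * expectation (\<lambda>\<omega>. (p * e k \<omega> $ 1 + c * \<xi> (Suc k) \<omega>)\<^sup>2)
          + expectation (\<lambda>\<omega>. (e k \<omega> $ 2)\<^sup>2) + expectation (\<lambda>\<omega>. (e k \<omega> $ 3)\<^sup>2)"
        unfolding sq_norm_eq \<delta>_Suc p_def[symmetric] c_def[symmetric]
        using Z(1)[where p = p and c = c] int_e by simp
      also have "\<dots> = 2 * p\<^sup>2 * expectation (\<lambda>\<omega>. (e k \<omega> $ 1)\<^sup>2)
          + expectation (\<lambda>\<omega>. (e k \<omega> $ 2)\<^sup>2) + expectation (\<lambda>\<omega>. (e k \<omega> $ 3)\<^sup>2) + 2 * c\<^sup>2"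
        unfolding Z(2) by simp
      also have "\<dots> \<le> expectation (\<lambda>\<omega>. (e k \<omega> $ 1)\<^sup>2)
          + expectation (\<lambda>\<omega>. (e k \<omega> $ 2)\<^sup>2) + expectation (\<lambda>\<omega>. (e k \<omega> $ 3)\<^sup>2) + 2 * \<epsilon>\<^sup>2"
        using mult_right_mono[OF gain, of "expectation (\<lambda>\<omega>. (e k \<omega> $ 1)\<^sup>2)"] noise by simp
      also have "\<dots> = expectation (\<lambda>\<omega>. (norm (e k \<omega>))\<^sup>2) + 2 * \<epsilon>\<^sup>2"
        unfolding norm_sq_3 using int_e by simp
      also have "\<dots> \<le> expectation (\<lambda>\<omega>. (1 - h / 4) * sq_norm (\<delta> k \<omega>)) + 2 * \<epsilon>\<^sup>2"
        by (intro add_right_mono integral_mono e_le) (auto simp: norm_sq_3 int int_e)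
      finally show ?thesis by simp
    qed
    have "limsup (\<lambda>k. ereal (?E k)) \<le> ereal (2 * \<epsilon>\<^sup>2 / (1 / 4 * h))"
      using rec h h1 by (intro limsup_le_of_affine_recursion) auto
    with int rec show ?thesis by (simp add: \<delta>_def)
  qed
  show ?thesis
  proof (intro exI conjI ballI)
    fix \<eta> h :: real assume "\<eta> \<in> {0<..<1}" "h \<in> {0<..<h\<^sub>c}"
    then have "0 < \<eta>" "\<eta> < 1" "0 < h" "h < h\<^sub>c" by simp_all
    from main[OF this]
    show "let E = (\<lambda>k. \<integral>\<omega>. sq_norm (filter_error \<alpha> b r \<epsilon> \<eta> h v m\<^sub>0 (\<lambda>j. \<xi> j \<omega>) k) \<partial>M) in
        (\<forall>k. integrable M (\<lambda>\<omega>. sq_norm (filter_error \<alpha> b r \<epsilon> \<eta> h v m\<^sub>0 (\<lambda>j. \<xi> j \<omega>) k))) \<and>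
        (\<forall>k. E (Suc k) \<le> (1 - 1 / 4 * h) * E k + 2 * \<epsilon>\<^sup>2) \<and>
        limsup (\<lambda>k. ereal (E k)) \<le> ereal (2 * \<epsilon>\<^sup>2 / (1 / 4 * h))" .
  qed (use hc in simp_all)
qed

end
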